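(* As formal power series in $z$, $$\sum_{n\ge0}\phi(n,n;T,L)\,\frac{z^n}{n!}=\frac{2\,e^{\frac{z}{1-z}}}{1-z}-1-2z-z^2.$$
   Context: A $(0,1)$-matrix is a matrix with all entries in $\{0,1\}$. A $2\times2$ submatrix of a matrix is obtained by choosing two rows $i_1<i_2$ and two columns $j_1<j_2$. Let $T=\begin{pmatrix}1&1\\0&0\end{pmatrix}$, $L=\begin{pmatrix}1&0\\1&0\end{pmatrix}$, with equivalence classes under row and column exchanges $[T]=\left\{\begin{pmatrix}1&1\\0&0\end{pmatrix},\begin{pmatrix}0&0\\1&1\end{pmatrix}\right\}$ and $[L]=\left\{\begin{pmatrix}1&0\\1&0\end{pmatrix},\begin{pmatrix}0&1\\0&1\end{pmatrix}\right\}$. For $n\ge1$, $\phi(n,n;T,L)$ is the number of $n\times n$ $(0,1)$-matrices having no $2\times2$ submatrix in $[T]\cup[L]$, and $\phi(0,0;T,L)=1$. *)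

theory Defs
  imports
    "Jordan_Normal_Form.DL_Submatrix"
    "HOL-Combinatorics.Permutations"
    "HOL-Computational_Algebra.Formal_Power_Series"
begin

definition zero_one_mats :: "nat \<Rightarrow> nat \<Rightarrow> nat mat set" where
  "zero_one_mats m n = {A \<in> carrier_mat m n. elements_mat A \<subseteq> {0, 1}}"

definition exchange_class :: "'a mat \<Rightarrow> 'a mat set" where
  "exchange_class Q =
     {mat (dim_row Q) (dim_col Q) (\<lambda>(i, j). Q $$ (p i, q j)) | p q.
        p permutes {..<dim_row Q} \<and> q permutes {..<dim_col Q}}"

definition submatrices_2x2 :: "'a mat \<Rightarrow> 'a mat set" where
  "submatrices_2x2 A =
     {submatrix A {i1, i2} {j1, j2} | i1 i2 j1 j2.
        i1 < i2 \<and> i2 < dim_row A \<and> j1 < j2 \<and> j2 < dim_col A}"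

definition phi :: "nat \<Rightarrow> nat \<Rightarrow> nat mat \<Rightarrow> nat mat \<Rightarrow> nat" where
  "phi m n P Q =
     card {A \<in> zero_one_mats m n.
             submatrices_2x2 A \<inter> (exchange_class P \<union> exchange_class Q) = {}}"

definition T_pat :: "nat mat" where
  "T_pat = mat_of_rows_list 2 [[1, 1], [0, 0]]"

definition L_pat :: "nat mat" where
  "L_pat = mat_of_rows_list 2 [[1, 0], [1, 0]]"

lemma permutes_lessThan_2: "p permutes {..<2::nat} \<longleftrightarrow> p = id \<or> p = transpose 0 1"
proof -
  have 2: "{..<2::nat} = {0, 1}" by auto
  show ?thesis
  proof
    assume "p permutes {..<2::nat}"
    then have p: "p permutes {0, 1}" unfolding 2 .
    then have "p 0 \<in> {0, 1}" "p 1 \<in> {0, 1}" "p 0 \<noteq> p 1"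
      using permutes_in_image[OF p, of 0] permutes_in_image[OF p, of 1]
      by (simp_all add: inj_eq[OF permutes_inj[OF p]])
    moreover have "p k = k" if "k \<noteq> 0" "k \<noteq> 1" for k
      using p that by (simp add: permutes_def)
    ultimately show "p = id \<or> p = transpose 0 1"
      unfolding fun_eq_iff transpose_def id_def by (metis insertE singletonD)
  qed (auto simp: permutes_id permutes_swap_id)
qed

lemma exchange_class_2x2:
  assumes "Q \<in> carrier_mat 2 2"
  shows "exchange_class Q =
    (\<lambda>(p, q). mat 2 2 (\<lambda>(i, j). Q $$ (p i, q j))) `
      ({id, transpose 0 1} \<times> {id, transpose 0 1})"
proof -
  have "dim_row Q = 2" "dim_col Q = 2" using assms by auto
  moreover have "{f p q | p q. (p = a \<or> p = b) \<and> (q = c \<or> q = d)} =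
      (\<lambda>(p, q). f p q) ` ({a, b} \<times> {c, d})"
    for f :: "(nat \<Rightarrow> nat) \<Rightarrow> (nat \<Rightarrow> nat) \<Rightarrow> 'a mat" and a b c d
    by auto
  ultimately show ?thesis
    unfolding exchange_class_def by (simp only: permutes_lessThan_2)
qed

lemma mat_2x2_eq_iff:
  "mat 2 2 f = mat 2 2 g \<longleftrightarrow>
    f (0, 0) = g (0, 0) \<and> f (0, 1) = g (0, 1) \<and> f (1, 0) = g (1, 0) \<and> f (1, 1) = g (1, 1)"
proof
  assume *: "mat 2 2 f = mat 2 2 g"
  have "f (i, j) = g (i, j)" if "i < 2" "j < 2" for i j
    using arg_cong[OF *, of "\<lambda>A. A $$ (i, j)"] that by simp
  then show "f (0, 0) = g (0, 0) \<and> f (0, 1) = g (0, 1) \<and> f (1, 0) = g (1, 0) \<and> f (1, 1) = g (1, 1)"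
    by simp
qed (auto simp: less_2_cases_iff intro!: eq_matI)

lemma exchange_class_T:
  "exchange_class T_pat =
     {mat_of_rows_list 2 [[1, 1], [0, 0]], mat_of_rows_list 2 [[0, 0], [1, 1]]}"
  by (subst exchange_class_2x2)
    (auto simp: T_pat_def mat_of_rows_list_def numeral_2_eq_2[symmetric] mat_2x2_eq_iff)

lemma exchange_class_L:
  "exchange_class L_pat =
     {mat_of_rows_list 2 [[1, 0], [1, 0]], mat_of_rows_list 2 [[0, 1], [0, 1]]}"
  by (subst exchange_class_2x2)
    (auto simp: L_pat_def mat_of_rows_list_def numeral_2_eq_2[symmetric] mat_2x2_eq_iff)

lemma submatrix_2x2:
  assumes "i1 < i2" "i2 < dim_row A" "j1 < j2" "j2 < dim_col A"
  shows "submatrix A {i1, i2} {j1, j2} =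
    mat_of_rows_list 2 [[A $$ (i1, j1), A $$ (i1, j2)], [A $$ (i2, j1), A $$ (i2, j2)]]"
proof -
  have pick: "pick {a, b} 0 = a" "pick {a, b} 1 = b" if "a < b" for a b :: nat
  proof -
    show 0: "pick {a, b} 0 = a"
      using that by (auto intro!: Least_equality)
    have "(LEAST x. x \<in> {a, b} \<and> x > a) = b"
      using that by (intro Least_equality) auto
    then show "pick {a, b} 1 = b"
      using 0 by simp
  qed
  have card: "card {i. i < n \<and> i \<in> {a, b}} = 2" if "a < b" "b < n" for a b n :: nat
  proof -
    have "{i. i < n \<and> i \<in> {a, b}} = {a, b}" using that by auto
    then show ?thesis using that by simp
  qed
  show ?thesis
    unfolding submatrix_def card[OF assms(1,2)] card[OF assms(3,4)] mat_of_rows_list_def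
    using pick[OF assms(1)] pick[OF assms(3)]
    by (simp add: numeral_2_eq_2[symmetric] mat_2x2_eq_iff del: pick.simps)
qed

text \<open>The empty matrix is the only one counted for \<open>m = n = 0\<close>, so the convention
  \<open>\<phi>(0,0;T,L) = 1\<close> needs no special case in the definition.\<close>

lemma phi_0_0: "phi 0 0 P Q = 1"
proof -
  have "{A \<in> zero_one_mats 0 0.
      submatrices_2x2 A \<inter> (exchange_class P \<union> exchange_class Q) = {}} = {0\<^sub>m 0 0}"
    by (auto simp: zero_one_mats_def submatrices_2x2_def elements_mat_def intro!: eq_matI)
  then show ?thesis by (simp add: phi_def)
qed

end

theory Submission
  imports Defs
begin

text \<open>A square matrix with entries in \<open>{0, 1}\<close> avoids \<open>[T] \<union> [L]\<close> iff it is a partial permutation matrix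
(no line, that is, no row or column, contains two ones) or the complement of one (no line contains two
zeros). One direction is clear: each forbidden pattern has two ones in one line and two
zeros in another. For the converse, two ones in a line and two zeros in a line together
force a forbidden pattern; up to transposition the two lines are two rows
(\<open>no_double_row_row\<close>) or a row and a column (\<open>no_double_row_col\<close>).

Both kinds of matrices correspond to partial injections of an \<open>n\<close>-element set into itself, of
which there are \<open>\<Sum>k\<le>n. (n choose k) * n! / k!\<close>, where \<open>n - k\<close> is the size of the domain. So
their exponential generating function has the coefficients \<open>\<Sum>k\<le>n. (n choose k) / k!\<close>, and
since \<open>n choose k\<close> is the coefficient of \<open>z^n\<close> in \<open>z^k / (1 - z)^(k+1)\<close>, it equals
\<open>e^(z / (1 - z)) / (1 - z)\<close>.

Adding the two families counts twice the matrices in which each line has at most one one and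
at most one zero. Lines then have length at most two, and there are 1, 2, 2 such
matrices for \<open>n = 0, 1, 2\<close> and none for larger \<open>n\<close>; their exponential generating function is
the correction \<open>1 + 2z + z^2\<close>.\<close>

section \<open>Avoidance forces sparse ones or sparse zeros\<close>

text \<open>Avoidance of \<open>[T] \<union> [L]\<close> for a matrix read as a binary relation: the two conjuncts exclude two
constant parallel lines of opposite values. Index pairs are unordered, which is harmless as
both classes are closed under exchanges, and makes the notion invariant under transposition.\<close>
definition rigid :: "'a set \<Rightarrow> 'b set \<Rightarrow> ('a \<Rightarrow> 'b \<Rightarrow> bool) \<Rightarrow> bool" where
  "rigid I J f \<longleftrightarrow> (\<forall>i\<in>I. \<forall>i'\<in>I. \<forall>j\<in>J. \<forall>j'\<in>J. i \<noteq> i' \<longrightarrow> j \<noteq> j' \<longrightarrow>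
     \<not> (f i j = f i j' \<and> f i' j = f i' j' \<and> f i j \<noteq> f i' j) \<and>
     \<not> (f i j = f i' j \<and> f i j' = f i' j' \<and> f i j \<noteq> f i j'))"

definition sparse :: "bool \<Rightarrow> 'a set \<Rightarrow> 'b set \<Rightarrow> ('a \<Rightarrow> 'b \<Rightarrow> bool) \<Rightarrow> bool" where
  "sparse v I J f \<longleftrightarrow>
     (\<forall>i\<in>I. \<forall>j\<in>J. \<forall>j'\<in>J. f i j = v \<longrightarrow> f i j' = v \<longrightarrow> j = j') \<and>
     (\<forall>i\<in>I. \<forall>i'\<in>I. \<forall>j\<in>J. f i j = v \<longrightarrow> f i' j = v \<longrightarrow> i = i')"

lemma rigid_rows:
  assumes "rigid I J f" "i \<in> I" "i' \<in> I" "i \<noteq> i'" "j \<in> J" "j' \<in> J" "j \<noteq> j'"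
    "f i j = f i j'" "f i' j = f i' j'"
  shows "f i j = f i' j"
  using assms unfolding rigid_def by blast

lemma rigid_transpose: "rigid I J f \<Longrightarrow> rigid J I (\<lambda>j i. f i j)"
  unfolding rigid_def by blast

lemma rigid_cols:
  assumes "rigid I J f" "i \<in> I" "i' \<in> I" "i \<noteq> i'" "j \<in> J" "j' \<in> J" "j \<noteq> j'"
    "f i j = f i' j" "f i j' = f i' j'"
  shows "f i j = f i j'"
  using assms unfolding rigid_def by blast

text \<open>The rows may coincide, in which case a further row \<open>i'\<close> is compared with row \<open>i\<close>. In either case
the other row has a one below one of the two ones of row \<open>i\<close>; on the two rows that column is
constantly one, so the columns \<open>l\<close> and \<open>l'\<close> cannot be constantly zero. This gives two parallel rows, one with two
ones and one with two zeros, in columns \<open>l\<close> and \<open>l'\<close>.\<close>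
lemma no_double_row_row:
  assumes r: "rigid I J f"
    and I: "i \<in> I" "k \<in> I" "i' \<in> I" "i' \<noteq> i"
    and J: "j \<in> J" "j' \<in> J" "l \<in> J" "l' \<in> J" "j \<noteq> j'" "l \<noteq> l'"
    and ones: "f i j" "f i j'" and zeros: "\<not> f k l" "\<not> f k l'"
  shows False
proof (cases "k = i")
  case True
  have "f i' j \<or> f i' j'"
    using rigid_rows[OF r, of i i' j j'] I J ones by auto
  then obtain m where m: "m \<in> {j, j'}" "f i' m" by auto
  have "f i' l" "f i' l'"
    using rigid_cols[OF r, of i i' m l] rigid_cols[OF r, of i i' m l'] I J m ones zeros True by auto
  then show False
    using rigid_rows[OF r, of i i' l l'] I J zeros True by auto
next
  case False
  have "f k j \<or> f k j'"
    using rigid_rows[OF r, of i k j j'] I J ones False by auto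
  then obtain m where m: "m \<in> {j, j'}" "f k m" by auto
  have "f i l" "f i l'"
    using rigid_cols[OF r, of i k m l] rigid_cols[OF r, of i k m l'] I J m ones zeros False by auto
  then show False
    using rigid_rows[OF r, of i k l l'] I J zeros False by auto
qed

text \<open>Two rows that vanish in column \<open>c\<close> share no one, since a column where both are one would give
two constant columns. Row \<open>i\<close> does share a one with \<open>k\<close> or \<open>k'\<close>, as neither may vanish in both
\<open>j\<close> and \<open>j'\<close>; so it has a one in column \<open>c\<close>. Rows \<open>k\<close> and \<open>k'\<close> share no one, so \<open>k\<close> vanishes in
\<open>j\<close> or \<open>j'\<close>: there and in \<open>c\<close>, row \<open>i\<close> has two ones and row \<open>k\<close> two zeros.\<close>
lemma no_double_row_col:
  assumes r: "rigid I J f"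
    and I: "i \<in> I" "k \<in> I" "k' \<in> I" "k \<noteq> k'"
    and J: "j \<in> J" "j' \<in> J" "c \<in> J" "j \<noteq> j'"
    and ones: "f i j" "f i j'" and zeros: "\<not> f k c" "\<not> f k' c"
  shows False
proof -
  have one: "f m j \<or> f m j'" if "m \<in> {k, k'}" for m
    using rigid_rows[OF r, of i m j j'] I J ones that by auto
  have excl: "\<not> (f k m \<and> f k' m)" if "m \<in> {j, j'}" for m
    using rigid_cols[OF r, of k k' m c] I J zeros that by auto
  have "f i c"
  proof (rule ccontr)
    assume c: "\<not> f i c"
    obtain m where m: "m \<in> {k, k'}" "m \<noteq> i" using I(4) by auto
    have "\<not> f m p" if "p \<in> {j, j'}" for p
      using rigid_cols[OF r, of i m p c] I J zeros that ones c m by auto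
    then show False using one[OF m(1)] by simp
  qed
  moreover obtain p where "p \<in> {j, j'}" "\<not> f k p"
    using one[of k'] excl by blast
  moreover have "c \<notin> {j, j'}"
    using one[of k] one[of k'] excl zeros by auto
  ultimately show False
    using rigid_rows[OF r, of i k p c] I J ones zeros by auto
qed

lemma rigid_imp_sparse:
  assumes r: "rigid I I f"
  shows "sparse True I I f \<or> sparse False I I f"
proof (rule ccontr)
  assume neg: "\<not> ?thesis"
  \<comment> \<open>Rows and columns have the same index set, so two columns guarantee a second row.\<close>
  have other: "\<exists>i'\<in>I. i' \<noteq> i" if "j \<in> I" "j' \<in> I" "j \<noteq> j'" for i j j'
    using that by metis
  have t: "rigid I I (\<lambda>j i. f i j)" using r by (rule rigid_transpose)
  have "(\<exists>i\<in>I. \<exists>j\<in>I. \<exists>j'\<in>I. j \<noteq> j' \<and> f i j \<and> f i j') \<or>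
        (\<exists>i\<in>I. \<exists>i'\<in>I. \<exists>j\<in>I. i \<noteq> i' \<and> f i j \<and> f i' j)"
    using neg unfolding sparse_def by blast
  moreover have "(\<exists>i\<in>I. \<exists>j\<in>I. \<exists>j'\<in>I. j \<noteq> j' \<and> \<not> f i j \<and> \<not> f i j') \<or>
        (\<exists>i\<in>I. \<exists>i'\<in>I. \<exists>j\<in>I. i \<noteq> i' \<and> \<not> f i j \<and> \<not> f i' j)"
    using neg unfolding sparse_def by blast
  ultimately show False
  proof (elim disjE bexE conjE)
    fix i j j' k l l'
    assume *: "i \<in> I" "j \<in> I" "j' \<in> I" "j \<noteq> j'" "f i j" "f i j'"
      "k \<in> I" "l \<in> I" "l' \<in> I" "l \<noteq> l'" "\<not> f k l" "\<not> f k l'"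
    then show False
      using other[of j j' i] no_double_row_row[OF r, of i k _ j j' l l'] by metis
  next
    fix i j j' k k' c
    assume *: "i \<in> I" "j \<in> I" "j' \<in> I" "j \<noteq> j'" "f i j" "f i j'"
      "k \<in> I" "k' \<in> I" "c \<in> I" "k \<noteq> k'" "\<not> f k c" "\<not> f k' c"
    then show False
      using no_double_row_col[OF r, of i k k' j j' c] by metis
  next
    fix i i' j k l l'
    assume *: "i \<in> I" "i' \<in> I" "j \<in> I" "i \<noteq> i'" "f i j" "f i' j"
      "k \<in> I" "l \<in> I" "l' \<in> I" "l \<noteq> l'" "\<not> f k l" "\<not> f k l'"
    then show False
      using no_double_row_col[OF t, of j l l' i i' k] by metis
  next
    fix i i' j k k' c
    assume *: "i \<in> I" "i' \<in> I" "j \<in> I" "i \<noteq> i'" "f i j" "f i' j"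
      "k \<in> I" "k' \<in> I" "c \<in> I" "k \<noteq> k'" "\<not> f k c" "\<not> f k' c"
    then show False
      using other[of i i' j] no_double_row_row[OF t, of j c _ i i' k k'] by metis
  qed
qed

lemma sparse_imp_rigid:
  assumes "sparse v I J f"
  shows "rigid I J f"
  unfolding rigid_def
proof (intro ballI impI)
  fix i i' j j'
  assume m: "i \<in> I" "i' \<in> I" "j \<in> J" "j' \<in> J" "i \<noteq> i'" "j \<noteq> j'"
  have "\<not> (f x j = v \<and> f x j' = v)" if "x \<in> {i, i'}" for x
    using assms m that unfolding sparse_def by blast
  moreover have "\<not> (f i y = v \<and> f i' y = v)" if "y \<in> {j, j'}" for y
    using assms m that unfolding sparse_def by blast
  ultimately show "\<not> (f i j = f i j' \<and> f i' j = f i' j' \<and> f i j \<noteq> f i' j) \<and>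
     \<not> (f i j = f i' j \<and> f i j' = f i' j' \<and> f i j \<noteq> f i j')"
    by (cases v) auto
qed

lemma rigid_iff_sparse: "rigid I I f \<longleftrightarrow> sparse True I I f \<or> sparse False I I f"
  using rigid_imp_sparse sparse_imp_rigid by blast

section \<open>Matrices\<close>

abbreviation support :: "nat mat \<Rightarrow> nat \<Rightarrow> nat \<Rightarrow> bool" where
  "support A \<equiv> (\<lambda>i j. A $$ (i, j) = 1)"

lemma zero_one_mats_iff:
  "A \<in> zero_one_mats m n \<longleftrightarrow>
     A \<in> carrier_mat m n \<and> (\<forall>i<m. \<forall>j<n. A $$ (i, j) = 0 \<or> A $$ (i, j) = 1)"
proof -
  have "elements_mat A \<subseteq> {0, 1} \<longleftrightarrow> (\<forall>i<m. \<forall>j<n. A $$ (i, j) = 0 \<or> A $$ (i, j) = 1)"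
    if "A \<in> carrier_mat m n"
    using that elements_matI[OF that] by (fastforce dest!: elements_matD)
  then show ?thesis unfolding zero_one_mats_def by blast
qed

lemma avoids_iff_rigid:
  assumes A: "A \<in> zero_one_mats m n"
  shows "submatrices_2x2 A \<inter> (exchange_class T_pat \<union> exchange_class L_pat) = {} \<longleftrightarrow>
    rigid {..<m} {..<n} (support A)"
proof -
  have dim: "dim_row A = m" "dim_col A = n" using A by (auto simp: zero_one_mats_iff)
  let ?f = "support A"
  define bad where "bad i i' j j' \<longleftrightarrow>
     (?f i j = ?f i j' \<and> ?f i' j = ?f i' j' \<and> ?f i j \<noteq> ?f i' j) \<or>
     (?f i j = ?f i' j \<and> ?f i j' = ?f i' j' \<and> ?f i j \<noteq> ?f i j')" for i i' j j'
  have bad: "submatrix A {i, i'} {j, j'} \<in> exchange_class T_pat \<union> exchange_class L_pat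
      \<longleftrightarrow> bad i i' j j'" if "i < i'" "i' < m" "j < j'" "j' < n" for i i' j j'
  proof -
    have "i < m" "j < n" using that by auto
    then have "A $$ (x, y) = 0 \<or> A $$ (x, y) = 1" if "x \<in> {i, i'}" "y \<in> {j, j'}" for x y
      using A that \<open>i' < m\<close> \<open>j' < n\<close> by (auto simp: zero_one_mats_iff)
    then have "A $$ (i, j) = 0 \<or> A $$ (i, j) = 1" "A $$ (i, j') = 0 \<or> A $$ (i, j') = 1"
      "A $$ (i', j) = 0 \<or> A $$ (i', j) = 1" "A $$ (i', j') = 0 \<or> A $$ (i', j') = 1" by auto
    moreover have "submatrix A {i, i'} {j, j'} =
        mat_of_rows_list 2 [[A $$ (i, j), A $$ (i, j')], [A $$ (i', j), A $$ (i', j')]]"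
      using that dim by (intro submatrix_2x2) auto
    ultimately show ?thesis
      unfolding exchange_class_T exchange_class_L bad_def
      by (elim disjE)
         (simp_all add: mat_of_rows_list_def numeral_2_eq_2[symmetric] mat_2x2_eq_iff)
  qed
  have sym: "bad i' i j j' = bad i i' j j'" "bad i i' j' j = bad i i' j j'" for i i' j j'
    unfolding bad_def by auto
  have "submatrices_2x2 A \<inter> (exchange_class T_pat \<union> exchange_class L_pat) = {} \<longleftrightarrow>
      (\<forall>i i' j j'. i < i' \<and> i' < m \<and> j < j' \<and> j' < n \<longrightarrow> \<not> bad i i' j j')"
    using bad unfolding submatrices_2x2_def dim by blast
  also have "\<dots> \<longleftrightarrow>
      (\<forall>i<m. \<forall>i'<m. \<forall>j<n. \<forall>j'<n. i \<noteq> i' \<longrightarrow> j \<noteq> j' \<longrightarrow> \<not> bad i i' j j')"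
    (is "?l \<longleftrightarrow> ?r")
  proof
    assume l: ?l
    show ?r
    proof (intro allI impI)
      fix i i' j j'
      assume "i < m" "i' < m" "j < n" "j' < n" "i \<noteq> i'" "j \<noteq> j'"
      then have "\<not> bad (min i i') (max i i') (min j j') (max j j')"
        using l by (auto simp: min_def max_def)
      then show "\<not> bad i i' j j'"
        using sym by (auto simp: min_def max_def split: if_splits)
    qed
  next
    assume r: ?r
    show ?l
    proof (intro allI impI)
      fix i i' j j'
      assume "i < i' \<and> i' < m \<and> j < j' \<and> j' < n"
      then have "i < m" "i' < m" "j < n" "j' < n" "i \<noteq> i'" "j \<noteq> j'" by auto
      then show "\<not> bad i i' j j'" using r by blast
    qed
  qed
  also have "\<dots> \<longleftrightarrow> rigid {..<m} {..<n} ?f"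
    unfolding rigid_def bad_def by blast
  finally show ?thesis .
qed

definition sparse_mats :: "bool \<Rightarrow> nat \<Rightarrow> nat mat set" where
  "sparse_mats v n = {A \<in> zero_one_mats n n. sparse v {..<n} {..<n} (support A)}"

lemma finite_zero_one_mats: "finite (zero_one_mats m n)"
proof -
  have "zero_one_mats m n \<subseteq> (\<lambda>f. mat m n f) ` ({..<m} \<times> {..<n} \<rightarrow>\<^sub>E {0, 1})"
  proof
    fix A assume A: "A \<in> zero_one_mats m n"
    have "A = mat m n (restrict (\<lambda>ij. A $$ ij) ({..<m} \<times> {..<n}))"
      using A by (intro eq_matI) (auto simp: zero_one_mats_iff)
    moreover have "A $$ ij \<in> {0, 1}" if "ij \<in> {..<m} \<times> {..<n}" for ij
      using A that by (cases ij) (simp add: zero_one_mats_iff)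
    then have "restrict (\<lambda>ij. A $$ ij) ({..<m} \<times> {..<n}) \<in> {..<m} \<times> {..<n} \<rightarrow>\<^sub>E {0, 1}"
      by (intro restrict_PiE_iff[THEN iffD2] ballI)
    ultimately show "A \<in> (\<lambda>f. mat m n f) ` ({..<m} \<times> {..<n} \<rightarrow>\<^sub>E {0, 1})"
      by (rule image_eqI)
  qed
  then show ?thesis by (rule finite_subset) (auto intro!: finite_PiE)
qed

lemma phi_eq_sparse:
  "phi n n T_pat L_pat + card (sparse_mats True n \<inter> sparse_mats False n) =
     card (sparse_mats True n) + card (sparse_mats False n)"
proof -
  have "{A \<in> zero_one_mats n n.
      submatrices_2x2 A \<inter> (exchange_class T_pat \<union> exchange_class L_pat) = {}} =
      sparse_mats True n \<union> sparse_mats False n"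
    unfolding sparse_mats_def using avoids_iff_rigid[of _ n n] rigid_iff_sparse by blast
  moreover have "finite (sparse_mats v n)" for v
    unfolding sparse_mats_def using finite_zero_one_mats by simp
  ultimately show ?thesis
    unfolding phi_def
    using card_Un_Int[of "sparse_mats True n" "sparse_mats False n"] by presburger
qed

section \<open>Counting sparse matrices\<close>

lemma falling_prod_times_fact:
  "k \<le> n \<Longrightarrow> prod ((-) n) {0..<k} * fact (n - k) = (fact n :: nat)"
proof (induction k)
  case (Suc k)
  have n: "n - k = Suc (n - Suc k)" using Suc.prems by arith
  have "prod ((-) n) {0..<Suc k} * fact (n - Suc k) = prod ((-) n) {0..<k} * fact (n - k)"
    unfolding n by (simp add: n algebra_simps)
  then show ?case using Suc.IH Suc.prems by (metis Suc_leD)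
qed simp

text \<open>A partial injection is a domain with an injection on it; the functions are \<open>undefined\<close> outside
the domain, so that each partial injection is represented once.\<close>
definition partial_injections :: "nat \<Rightarrow> (nat set \<times> (nat \<Rightarrow> nat)) set" where
  "partial_injections n = (SIGMA D:Pow {..<n}. {f \<in> D \<rightarrow>\<^sub>E {..<n}. inj_on f D})"

lemma card_partial_injections:
  "rat_of_nat (card (partial_injections n)) = (\<Sum>k\<le>n. of_nat (n choose k) * fact n / fact k)"
proof -
  have fin: "finite {f \<in> D \<rightarrow>\<^sub>E {..<n}. inj_on f D}" if "D \<subseteq> {..<n}" for D
    using that by (auto intro!: finite_PiE finite_subset[OF that])
  have c: "card {f \<in> D \<rightarrow>\<^sub>E {..<n}. inj_on f D} = fact n div fact (n - card D)"
    if "D \<subseteq> {..<n}" for D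
  proof -
    have "finite D" using that finite_subset by auto
    moreover have "card D \<le> n" using card_mono[OF _ that] by simp
    ultimately show ?thesis
      using card_inj_on_subset_funcset[of D "{..<n}" D]
      by (simp flip: falling_prod_times_fact)
  qed
  have "card (partial_injections n) = (\<Sum>D\<in>Pow {..<n}. fact n div fact (n - card D))"
    unfolding partial_injections_def using fin c by (subst card_SigmaI) auto
  also have "\<dots> = (\<Sum>k\<in>{..n}. \<Sum>D\<in>{D \<in> Pow {..<n}. card D = k}. fact n div fact (n - card D))"
    by (rule sum.group[symmetric]) (auto dest: card_mono[rotated])
  also have "\<dots> = (\<Sum>k\<in>{..n}. (n choose k) * (fact n div fact (n - k)))"
  proof (rule sum.cong[OF refl])
    fix k
    have "card {D \<in> Pow {..<n}. card D = k} = n choose k"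
      using n_subsets[of "{..<n}" k] by simp
    then show "(\<Sum>D\<in>{D \<in> Pow {..<n}. card D = k}. fact n div fact (n - card D)) =
        (n choose k) * (fact n div fact (n - k))" by simp
  qed
  also have "\<dots> = (\<Sum>k\<in>{..n}. (n choose k) * (fact n div fact k))"
    by (rule sum.reindex_bij_witness[of _ "\<lambda>k. n - k" "\<lambda>k. n - k"])
       (auto simp: binomial_symmetric[symmetric])
  finally have "card (partial_injections n) = (\<Sum>k\<in>{..n}. (n choose k) * (fact n div fact k))" .
  moreover have "rat_of_nat (fact n div fact k) = fact n / fact k" if kn: "k \<le> n" for k
  proof -
    obtain m where m: "fact n = fact k * (m :: nat)"
      using fact_dvd[OF kn, where 'a = nat] unfolding dvd_def by blast
    have "fact n = (fact k * of_nat m :: rat)"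
      using arg_cong[OF m, of rat_of_nat] by simp
    then show ?thesis using m by simp
  qed
  ultimately show ?thesis by simp
qed

text \<open>The positions of the value \<open>v\<close> form the graph of a partial injection. Treating both values at
once spares a separate bijection by complementation.\<close>
lemma card_sparse_mats: "card (sparse_mats v n) = card (partial_injections n)"
proof -
  define entry where "entry b = (if b = v then 1 else 0 :: nat)" for b
  define F where "F = (\<lambda>(D, f). mat n n (\<lambda>(i, j). entry (i \<in> D \<and> f i = j)))"
  have val: "(support (F (D, f)) i j = v) \<longleftrightarrow> (i \<in> D \<and> f i = j)" if "i < n" "j < n" for D f i j
    using that by (auto simp: F_def entry_def)
  have "bij_betw F (partial_injections n) (sparse_mats v n)"
    unfolding bij_betw_def
  proof (intro conjI inj_onI subset_antisym subsetI)
    fix x y assume x: "x \<in> partial_injections n" and y: "y \<in> partial_injections n"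
      and eq: "F x = F y"
    obtain D f E g where xy: "x = (D, f)" "y = (E, g)" by (metis surj_pair)
    have D: "D \<subseteq> {..<n}" "f \<in> D \<rightarrow>\<^sub>E {..<n}" and E: "E \<subseteq> {..<n}" "g \<in> E \<rightarrow>\<^sub>E {..<n}"
      using x y by (auto simp: xy partial_injections_def)
    have *: "(i \<in> D \<and> f i = j) \<longleftrightarrow> (i \<in> E \<and> g i = j)" if "i < n" "j < n" for i j
      using val[OF that, of D f] val[OF that, of E g] eq xy by simp
    have iD: "i < n \<and> f i < n" if "i \<in> D" for i using D that by auto
    have iE: "i < n \<and> g i < n" if "i \<in> E" for i using E that by auto
    have "D = E" using * iD iE by blast
    moreover have "f = g"
    proof (rule PiE_ext[OF D(2)])
      show "g \<in> D \<rightarrow>\<^sub>E {..<n}" using E \<open>D = E\<close> by simp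
      show "f i = g i" if "i \<in> D" for i using *[of i "f i"] iD that by auto
    qed
    ultimately show "x = y" using xy by simp
  next
    fix A assume "A \<in> F ` partial_injections n"
    then obtain D f where A: "A = F (D, f)" and f: "inj_on f D"
      by (auto simp: partial_injections_def)
    have "A \<in> zero_one_mats n n"
      by (auto simp: zero_one_mats_iff A F_def entry_def)
    moreover have "sparse v {..<n} {..<n} (support A)"
      unfolding sparse_def A using val[of _ _ D f] f by (auto dest: inj_onD)
    ultimately show "A \<in> sparse_mats v n" by (simp add: sparse_mats_def)
  next
    fix A assume "A \<in> sparse_mats v n"
    then have A: "A \<in> carrier_mat n n" "\<And>i j. i < n \<Longrightarrow> j < n \<Longrightarrow> A $$ (i, j) = 0 \<or> A $$ (i, j) = 1"
      and row: "\<And>i j j'. i < n \<Longrightarrow> j < n \<Longrightarrow> j' < n \<Longrightarrow>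
        support A i j = v \<Longrightarrow> support A i j' = v \<Longrightarrow> j = j'"
      and col: "\<And>i i' j. i < n \<Longrightarrow> i' < n \<Longrightarrow> j < n \<Longrightarrow>
        support A i j = v \<Longrightarrow> support A i' j = v \<Longrightarrow> i = i'"
      by (auto simp: sparse_mats_def sparse_def zero_one_mats_iff)
    define D where "D = {i. i < n \<and> (\<exists>j<n. support A i j = v)}"
    define f where "f = restrict (\<lambda>i. SOME j. j < n \<and> support A i j = v) D"
    have f: "f i < n \<and> support A i (f i) = v" if "i \<in> D" for i
    proof -
      have "\<exists>j. j < n \<and> support A i j = v" using that by (auto simp: D_def)
      from someI_ex[OF this] show ?thesis using that by (simp add: f_def)
    qed
    have D: "i < n" if "i \<in> D" for i using that by (simp add: D_def)
    have "(D, f) \<in> partial_injections n"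
    proof -
      have "f \<in> D \<rightarrow>\<^sub>E {..<n}" using f by (auto simp: f_def)
      moreover have "inj_on f D"
      proof (rule inj_onI)
        fix x y assume "x \<in> D" "y \<in> D" "f x = f y"
        then show "x = y" using f[of x] f[of y] D[of x] D[of y] col[of x y "f x"] by simp
      qed
      ultimately show ?thesis using D by (auto simp: partial_injections_def)
    qed
    moreover have "F (D, f) = A"
    proof (rule eq_matI)
      fix i j assume "i < dim_row A" "j < dim_col A"
      then have ij: "i < n" "j < n" using A by auto
      have "support A i j = v \<longleftrightarrow> i \<in> D \<and> f i = j"
      proof
        assume s: "support A i j = v"
        then have "i \<in> D" using ij unfolding D_def by blast
        then show "i \<in> D \<and> f i = j" using f[of i] row[of i j "f i"] ij s by simp
      next
        assume "i \<in> D \<and> f i = j"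
        then show "support A i j = v" using f[of i] by blast
      qed
      then show "F (D, f) $$ (i, j) = A $$ (i, j)"
        using ij A(2)[OF ij] by (auto simp: F_def entry_def)
    qed (use A in \<open>auto simp: F_def\<close>)
    ultimately show "A \<in> F ` partial_injections n" by (metis image_eqI)
  qed
  then show ?thesis using bij_betw_same_card by metis
qed

section \<open>Matrices that are sparse in both values\<close>

lemma sparse_both_row:
  assumes "sparse True I J f" "sparse False I J f" "i \<in> I" "j \<in> J" "j' \<in> J" "j \<noteq> j'"
  shows "f i j \<noteq> f i j'"
  using assms unfolding sparse_def by meson

lemma sparse_both_col:
  assumes "sparse True I J f" "sparse False I J f" "i \<in> I" "i' \<in> I" "j \<in> J" "i \<noteq> i'"
  shows "f i j \<noteq> f i' j"
  using assms unfolding sparse_def by meson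

text \<open>Within a line of a matrix that is sparse in both values all entries differ, so \<open>n \<le> 2\<close>. For
\<open>n = 1\<close> both matrices qualify, for \<open>n = 2\<close> the two permutation matrices.\<close>
lemma card_sparse_Int:
  "card (sparse_mats True n \<inter> sparse_mats False n) =
     (if n = 0 then 1 else if n \<le> 2 then 2 else 0)"
proof -
  let ?S = "sparse_mats True n \<inter> sparse_mats False n"
  consider "n = 0" | "n = 1" | "n = 2" | "n \<ge> 3" by linarith
  then show ?thesis
  proof cases
    case 1
    then have "?S = {0\<^sub>m 0 0}"
      by (auto simp: sparse_mats_def zero_one_mats_iff sparse_def intro!: eq_matI)
    then show ?thesis using 1 by simp
  next
    case 2
    have "?S = {mat 1 1 (\<lambda>_. 0), mat 1 1 (\<lambda>_. 1)}" (is "_ = {?O, ?I}")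
    proof (intro subset_antisym subsetI)
      fix A assume "A \<in> ?S"
      then have "A \<in> carrier_mat 1 1" "A $$ (0, 0) = 0 \<or> A $$ (0, 0) = 1"
        using 2 by (auto simp: sparse_mats_def zero_one_mats_iff)
      then have "A = ?O \<or> A = ?I" by (auto intro!: eq_matI)
      then show "A \<in> {?O, ?I}" by auto
    qed (use 2 in \<open>auto simp: sparse_mats_def zero_one_mats_iff sparse_def\<close>)
    moreover have "?O \<noteq> (?I :: nat mat)"
      by (metis index_mat(1) less_numeral_extra(1) zero_neq_one)
    ultimately show ?thesis using 2 by simp
  next
    case 3
    let ?d = "\<lambda>b. mat 2 2 (\<lambda>(i, j). if (i = j) = b then 1 else 0 :: nat)"
    have "?S = {?d True, ?d False}"
    proof (intro subset_antisym subsetI)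
      fix A assume "A \<in> ?S"
      then have A: "A \<in> carrier_mat 2 2" "\<And>i j. i < 2 \<Longrightarrow> j < 2 \<Longrightarrow> A $$ (i, j) = 0 \<or> A $$ (i, j) = 1"
        and sp: "sparse True {..<2} {..<2} (support A)" "sparse False {..<2} {..<2} (support A)"
        using 3 unfolding sparse_mats_def zero_one_mats_iff by blast+
      have n: "support A 0 0 \<noteq> support A 0 1" "support A 1 0 \<noteq> support A 1 1"
        "support A 0 0 \<noteq> support A 1 0"
        using sparse_both_row[OF sp, of 0 0 1] sparse_both_row[OF sp, of 1 0 1]
          sparse_both_col[OF sp, of 0 1 0] by auto
      have "A = ?d (support A 0 0)"
        using A(1) A(2)[of 0 0] A(2)[of 0 1] A(2)[of 1 0] A(2)[of 1 1] n
        by (intro eq_matI) (auto simp: less_2_cases_iff)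
      then show "A \<in> {?d True, ?d False}"
        by (cases "support A 0 0") auto
    qed (use 3 in \<open>auto simp: sparse_mats_def zero_one_mats_iff sparse_def less_2_cases_iff\<close>)
    moreover have "?d True \<noteq> ?d False"
      by (simp add: mat_2x2_eq_iff)
    ultimately show ?thesis using 3 by simp
  next
    case 4
    have "?S = {}"
    proof -
      have False if sp: "sparse True {..<n} {..<n} f" "sparse False {..<n} {..<n} f"
        for f :: "nat \<Rightarrow> nat \<Rightarrow> bool"
        using sparse_both_row[OF sp, of 0 0 1] sparse_both_row[OF sp, of 0 0 2]
          sparse_both_row[OF sp, of 0 1 2] 4 by auto
      then show ?thesis by (auto simp: sparse_mats_def)
    qed
    then show ?thesis using 4 by simp
  qed
qed

section \<open>Generating functions\<close>

text \<open>Pascal's rule says that the columns of Pascal's triangle satisfy \<open>(1 - z) B (k + 1) = z B k\<close>.\<close>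
lemma binomial_column_fps:
  "(fps_X / (1 - fps_X)) ^ k * inverse (1 - fps_X) = Abs_fps (\<lambda>n. of_nat (n choose k) :: rat)"
proof (induction k)
  case 0
  show ?case by (simp add: fps_inverse_one_minus_fps_X)
next
  case (Suc k)
  let ?B = "\<lambda>k. Abs_fps (\<lambda>n. of_nat (n choose k) :: rat)"
  have inv: "inverse (1 - fps_X) * (1 - fps_X) = (1 :: rat fps)"
    by (rule inverse_mult_eq_1) simp
  have pascal: "(1 - fps_X) * ?B (Suc k) = fps_X * ?B k"
  proof (rule fps_ext)
    fix n show "fps_nth ((1 - fps_X) * ?B (Suc k)) n = fps_nth (fps_X * ?B k) n"
      by (cases n) (simp_all add: left_diff_distrib)
  qed
  have "(fps_X / (1 - fps_X)) ^ Suc k * inverse (1 - fps_X) = fps_X / (1 - fps_X) * ?B k"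
    using Suc by (simp add: mult.assoc)
  also have "\<dots> = inverse (1 - fps_X) * (fps_X * ?B k)"
    by (simp add: fps_divide_unit mult_ac)
  also have "\<dots> = ?B (Suc k)"
    unfolding pascal[symmetric] mult.assoc[symmetric] inv by simp
  finally show ?case .
qed

text \<open>The coefficient of \<open>z^n\<close> in \<open>(\<Sum>k. a k * b^k) * c\<close>, computed termwise: as \<open>b\<close> has no constant
term, \<open>b^k\<close> does not contribute for \<open>k > n\<close>.\<close>
lemma compose_mult_nth:
  fixes a b c :: "'a :: comm_ring_1 fps"
  assumes "fps_nth b 0 = 0"
  shows "fps_nth ((a oo b) * c) n = (\<Sum>k\<le>n. fps_nth a k * fps_nth (b ^ k * c) n)"
proof -
  have "fps_nth (a oo b) i = (\<Sum>k\<le>n. fps_nth a k * fps_nth (b ^ k) i)" if "i \<le> n" for i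
    unfolding fps_compose_nth using that startsby_zero_power_prefix[OF assms]
    by (intro sum.mono_neutral_left) auto
  then have "fps_nth ((a oo b) * c) n = (\<Sum>i=0..n. (\<Sum>k\<le>n. fps_nth a k * fps_nth (b ^ k) i) * fps_nth c (n - i))"
    by (simp add: fps_mult_nth)
  also have "\<dots> = (\<Sum>k\<le>n. fps_nth a k * fps_nth (b ^ k * c) n)"
    unfolding fps_mult_nth sum_distrib_left sum_distrib_right
    by (subst sum.swap) (simp add: mult.assoc)
  finally show ?thesis .
qed

lemma partial_injections_egf:
  "Abs_fps (\<lambda>n. of_nat (card (partial_injections n)) / fact n :: rat) =
     (fps_exp 1 oo (fps_X / (1 - fps_X))) / (1 - fps_X)"
proof (rule fps_ext)
  fix n
  let ?g = "fps_X / (1 - fps_X) :: rat fps"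
  have "(fps_exp 1 oo ?g) / (1 - fps_X) = (fps_exp 1 oo ?g) * inverse (1 - fps_X)"
    by (rule fps_divide_unit) simp
  moreover have "fps_nth ((fps_exp 1 oo ?g) * inverse (1 - fps_X)) n =
      (\<Sum>k\<le>n. fps_nth (fps_exp 1) k * fps_nth (?g ^ k * inverse (1 - fps_X)) n)"
    by (rule compose_mult_nth) (simp add: fps_divide_unit)
  ultimately have "fps_nth ((fps_exp 1 oo ?g) / (1 - fps_X)) n =
      (\<Sum>k\<le>n. of_nat (n choose k) / fact k :: rat)"
    unfolding binomial_column_fps by simp
  also have "\<dots> = of_nat (card (partial_injections n)) / fact n"
    unfolding card_partial_injections sum_divide_distrib by simp
  finally show "fps_nth (Abs_fps (\<lambda>n. of_nat (card (partial_injections n)) / fact n :: rat)) n =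
      fps_nth ((fps_exp 1 oo (fps_X / (1 - fps_X))) / (1 - fps_X)) n" by simp
qed

theorem mainTheorem9:
  shows "(Abs_fps (\<lambda>n. of_nat (phi n n T_pat L_pat) / fact n) :: rat fps) =
    2 * (fps_exp 1 oo (fps_X / (1 - fps_X))) / (1 - fps_X) - 1 - 2 * fps_X - fps_X ^ 2"
proof (rule fps_ext)
  fix n
  let ?G = "(fps_exp 1 oo (fps_X / (1 - fps_X))) / (1 - fps_X) :: rat fps"
  let ?c = "card (sparse_mats True n \<inter> sparse_mats False n)"
  have "rat_of_nat (phi n n T_pat L_pat) + of_nat ?c =
      2 * of_nat (card (partial_injections n))"
    using arg_cong[OF phi_eq_sparse[of n], of rat_of_nat] by (simp add: card_sparse_mats)
  then have "rat_of_nat (phi n n T_pat L_pat) / fact n =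
      2 * (of_nat (card (partial_injections n)) / fact n) - of_nat ?c / fact n"
    by (simp add: field_simps)
  also have "of_nat (card (partial_injections n)) / fact n = fps_nth ?G n"
    by (simp flip: partial_injections_egf)
  also have "of_nat ?c / fact n = fps_nth (1 + 2 * fps_X + fps_X ^ 2 :: rat fps) n"
  proof -
    consider "n = 0" | "n = 1" | "n = 2" | "n \<ge> 3" by linarith
    then show ?thesis
      unfolding card_sparse_Int
      by cases (auto simp: fps_X_power_nth fps_numeral_fps_const fps_X_nth fact_numeral)
  qed
  finally have "rat_of_nat (phi n n T_pat L_pat) / fact n =
      2 * fps_nth ?G n - fps_nth (1 + 2 * fps_X + fps_X ^ 2 :: rat fps) n" .
  moreover have "2 * (fps_exp 1 oo (fps_X / (1 - fps_X))) / (1 - fps_X) = 2 * ?G"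
    by (simp add: fps_divide_unit mult.assoc)
  ultimately show "fps_nth (Abs_fps (\<lambda>n. rat_of_nat (phi n n T_pat L_pat) / fact n)) n =
      fps_nth (2 * (fps_exp 1 oo (fps_X / (1 - fps_X))) / (1 - fps_X) - 1 - 2 * fps_X - fps_X ^ 2) n"
    by (simp add: fps_numeral_fps_const)
qed

end
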